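(* Let $0<\alpha,\beta,\gamma,\delta<1$, and let $X,X'$ (indexed by $\{0,1\}^4$) and $L,L',R,R'$ (indexed by $\{0,1\}^3$) be the tensors given explicitly in the context; they depend on $\alpha,\beta,\gamma,\delta$ but not on $n$. Then all components of these six tensors are strictly positive and, for every even $n\ge 4$, the vectors $p,p'\in\mathbb{R}^{2^n}$ with components $$p_{s_1,\dots,s_n}=L_{s_1s_2s_3}X_{s_2s_3s_4s_5}X_{s_4s_5s_6s_7}\cdots X_{s_{n-4}s_{n-3}s_{n-2}s_{n-1}}R_{s_{n-2}s_{n-1}s_n},$$ $$p'_{s_1,\dots,s_n}=L'_{s_1s_2s_3}X'_{s_2s_3s_4s_5}X'_{s_4s_5s_6s_7}\cdots X'_{s_{n-4}s_{n-3}s_{n-2}s_{n-1}}R'_{s_{n-2}s_{n-1}s_n}$$ (for $n=4$ there are no $X$, $X'$ factors) satisfy $$U_{\rm e}\,p=p',\qquad U_{\rm o}\,p'=p .$$ In other words, up to normalization, $p$ and $p'$ are the non-equilibrium steady state probability vectors on the two temporal layers.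
   Context: Model. Let $\mathbb{Z}_2=\{0,1\}$ and $\chi(w,c,e)= c+w+e+we \pmod 2$ for $w,c,e\in\mathbb{Z}_2$ (the middle argument is the cell being updated). Vectors $p\in\mathbb{R}^{2^n}=(\mathbb{R}^2)^{\otimes n}$ have components $p_{s_1,\dots,s_n}$ indexed by configurations in $\mathbb{Z}_2^n$; matrices act on column vectors (first index = row = final configuration, second index = column = initial configuration). Bulk: $P$ is the $8\times 8$ permutation matrix $P_{(s,s',s''),(t,t',t'')}=\delta_{s,t}\,\delta_{s',\chi(t,t',t'')}\,\delta_{s'',t''}$. Boundaries: $E^{\alpha,\beta}=\begin{pmatrix}1-\alpha&\beta\\ \alpha&1-\beta\end{pmatrix}$, $\tilde P^{\rm L}_{(s',s''),(t',t'')}=\frac12\sum_{s=0}^1 P_{(s,s',s''),(s,t',t'')}$, $\tilde P^{\rm R}_{(s,s'),(t,t')}=\frac12\sum_{s''=0}^1 P_{(s,s',s''),(t,t',s'')}$, $P^{\rm L}=\tilde P^{\rm L}(E^{\alpha,\beta}\otimes \mathbb{1}_2)$, $P^{\rm R}=\tilde P^{\rm R}(\mathbb{1}_2\otimes E^{\gamma,\delta})$. Propagators: with $P_{k,k+1,k+2}=\mathbb{1}_{2^{k-1}}\otimes P\otimes \mathbb{1}_{2^{n-k-2}}$, $P^{\rm L}_{12}=P^{\rm L}\otimes \mathbb{1}_{2^{n-2}}$, $P^{\rm R}_{n-1,n}=\mathbb{1}_{2^{n-2}}\otimes P^{\rm R}$, $U_{\rm e}=P_{123}P_{345}\cdots P_{n-3,n-2,n-1}P^{\rm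 R}_{n-1,n}$, $U_{\rm o}=P_{n-2,n-1,n}\cdots P_{456}P_{234}P^{\rm L}_{12}$. The full Markov propagator is $U=U_{\rm o}U_{\rm e}$ and a non-equilibrium steady state is a probability vector fixed by $U$. Tensors. Put $\lambda=\alpha-\beta$, $\mu=\gamma-\delta$, $A=\lambda\mu+\lambda-2$, $B=\lambda\mu+\mu-2$, and $x_1=\frac{(\lambda+2)(\mu+2)}{AB}$, $x_2=-\frac{A^2}{(\lambda+2)B}$, $x_3=-\frac{B^2}{(\mu+2)A}$, $x_4=-\frac{(\mu+2)A}{B^2}$, $x_5=-\frac{(\lambda+2)B}{A^2}$, $x_6=-\frac{A\,[(\lambda+1)\mu(\lambda+1-2\alpha)-2(\alpha+1)\lambda-2]}{(\lambda+2)B}$, $x_7=-\frac{(\lambda+1)A}{\lambda+2}$, $x_8=\frac{(\lambda-1)(\mu+2)}{B}$, $x_9=\frac{A\,[(\lambda+1)\mu(\lambda+1-2\alpha)-2\alpha\lambda+2]}{(\lambda+2)B}$, $x_{10}=\frac{(\lambda-1)A}{\lambda+2}$, $x_{11}=\frac{AB}{(\lambda+2)(\mu+2)}$, $x_{12}=\frac{A}{B}$, $x_{13}=\frac{(\lambda+2)(\mu-1)}{B}$, $x_{14}=-\frac{(\lambda+2)(\mu+1)}{B}$, $x_{15}=-\frac{(\lambda+2)(\mu+1)}{A}$, $x_{16}=\frac{(\lambda+2)(\mu-1)}{A}$, $x_{17}=-\frac{(\lambda+2)[\lambda(\mu+1)(\mu+1-2\gamma)-2(\gamma+1)\mu-2]}{AB}$,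 $x_{18}=\frac{(\lambda+2)(\mu+2)}{AB}$, $x_{19}=\frac{(\lambda+2)[\lambda(\mu+1)(\mu+1-2\gamma)-2\gamma\mu+2]}{AB}$, $x_{20}=-\frac{\lambda+2}{A}$, $x_{21}=\frac{\lambda(\mu+1)(\mu+1-2\gamma)-2(\gamma+1)\mu-2}{B}$, $x_{22}=-\frac{\lambda(\mu+1)(\mu+1-2\gamma)-2\gamma\mu+2}{B}$. Then: $X_{00ss'}=X'_{00ss'}=1$ and $X_{10ss'}=X'_{10ss'}=x_1$ for all $s,s'\in\{0,1\}$; $X_{0100}=X_{0101}=x_1$, $X_{0110}=x_2$, $X_{0111}=x_4$, $X_{1100}=X_{1101}=x_5$, $X_{1110}=1$, $X_{1111}=x_1$; $X'_{0100}=X'_{0101}=x_1$, $X'_{0110}=x_3$, $X'_{0111}=x_5$, $X'_{1100}=X'_{1101}=x_4$, $X'_{1110}=1$, $X'_{1111}=x_1$; $L_{000}=1$, $L_{001}=1$, $L_{010}=x_7$, $L_{011}=x_6$, $L_{100}=1$, $L_{101}=1$, $L_{110}=x_{10}$, $L_{111}=x_9$; $L'_{000}=1$, $L'_{001}=x_6$, $L'_{010}=x_7$, $L'_{011}=1$, $L'_{100}=x_8$, $L'_{101}=x_9$, $L'_{110}=x_{11}$, $L'_{111}=1$; $R_{000}=x_{12}$, $R_{001}=x_{13}$, $R_{010}=x_{14}$, $R_{011}=x_{12}$, $R_{100}=x_{17}$, $R_{101}=x_{19}$, $R_{110}=x_{20}$, $R_{111}=x_{20}$; $R'_{000}=1$,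 $R'_{001}=1$, $R'_{010}=x_{15}$, $R'_{011}=x_{16}$, $R'_{100}=x_{18}$, $R'_{101}=x_{18}$, $R'_{110}=x_{21}$, $R'_{111}=x_{22}$. *)

theory Defs
  imports Complex_Main "HOL-Library.Z2" "Jordan_Normal_Form.Matrix"
begin

text \<open>
  A vector in \<open>(\<real>\<^sup>2)\<^sup>\<otimes>\<^sup>n\<close> is a vector of dimension \<open>2 ^ n\<close>.  The index of the configuration
  \<open>s\<^sub>1, \<dots>, s\<^sub>n\<close> is the number with binary digits \<open>s\<^sub>1 \<dots> s\<^sub>n\<close>, most significant digit first, which
  agrees with the Kronecker product below.  The term \<open>site n i k\<close> is the digit \<open>s\<^sub>k\<close>
  (for \<open>1 \<le> k \<le> n\<close>) of the index \<open>i < 2 ^ n\<close>; here \<^const>\<open>of_nat\<close> reduces modulo 2.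
\<close>

definition site :: "nat \<Rightarrow> nat \<Rightarrow> nat \<Rightarrow> bit" where
  "site n i k = of_nat (i div 2 ^ (n - k))"

definition kron :: "real mat \<Rightarrow> real mat \<Rightarrow> real mat" (infixl \<open>\<otimes>\<^sub>K\<close> 72) where
  "A \<otimes>\<^sub>K B = mat (dim_row A * dim_row B) (dim_col A * dim_col B)
     (\<lambda>(i, j). A $$ (i div dim_row B, j div dim_col B) * B $$ (i mod dim_row B, j mod dim_col B))"

definition chi :: "bit \<Rightarrow> bit \<Rightarrow> bit \<Rightarrow> bit" where
  "chi w c e = c + w + e + w * e"

definition bulk_entry :: "bit \<times> bit \<times> bit \<Rightarrow> bit \<times> bit \<times> bit \<Rightarrow> real" where
  "bulk_entry = (\<lambda>(s, s', s'') (t, t', t'').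
     of_bool (s = t) * of_bool (s' = chi t t' t'') * of_bool (s'' = t''))"

definition bulk_mat :: "real mat" where
  "bulk_mat = mat 8 8 (\<lambda>(i, j).
     bulk_entry (site 3 i 1, site 3 i 2, site 3 i 3) (site 3 j 1, site 3 j 2, site 3 j 3))"

definition stoch_mat :: "real \<Rightarrow> real \<Rightarrow> real mat" where
  "stoch_mat a b = mat_of_rows_list 2 [[1 - a, b], [a, 1 - b]]"

definition left_avg_mat :: "real mat" where
  "left_avg_mat = mat 4 4 (\<lambda>(i, j). 1 / 2 *
     (\<Sum>s\<in>{0, 1}. bulk_entry (s, site 2 i 1, site 2 i 2) (s, site 2 j 1, site 2 j 2)))"

definition right_avg_mat :: "real mat" where
  "right_avg_mat = mat 4 4 (\<lambda>(i, j). 1 / 2 *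
     (\<Sum>s''\<in>{0, 1}. bulk_entry (site 2 i 1, site 2 i 2, s'') (site 2 j 1, site 2 j 2, s'')))"

definition left_mat :: "real \<Rightarrow> real \<Rightarrow> real mat" where
  "left_mat \<alpha> \<beta> = left_avg_mat * (stoch_mat \<alpha> \<beta> \<otimes>\<^sub>K 1\<^sub>m 2)"

definition right_mat :: "real \<Rightarrow> real \<Rightarrow> real mat" where
  "right_mat \<gamma> \<delta> = right_avg_mat * (1\<^sub>m 2 \<otimes>\<^sub>K stoch_mat \<gamma> \<delta>)"

text \<open>\<open>bulk_at n k\<close> is \<open>P\<close> acting on the sites \<open>k, k + 1, k + 2\<close> of a chain of length \<open>n\<close>.\<close>

definition bulk_at :: "nat \<Rightarrow> nat \<Rightarrow> real mat" where
  "bulk_at n k = 1\<^sub>m (2 ^ (k - 1)) \<otimes>\<^sub>K bulk_mat \<otimes>\<^sub>K 1\<^sub>m (2 ^ (n - k - 2))"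

definition left_at :: "real \<Rightarrow> real \<Rightarrow> nat \<Rightarrow> real mat" where
  "left_at \<alpha> \<beta> n = left_mat \<alpha> \<beta> \<otimes>\<^sub>K 1\<^sub>m (2 ^ (n - 2))"

definition right_at :: "real \<Rightarrow> real \<Rightarrow> nat \<Rightarrow> real mat" where
  "right_at \<gamma> \<delta> n = 1\<^sub>m (2 ^ (n - 2)) \<otimes>\<^sub>K right_mat \<gamma> \<delta>"

text \<open>
  For even \<open>n\<close> the bulk factors of \<open>U_even\<close> start at the sites \<open>1, 3, \<dots>, n - 3\<close> and those of
  \<open>U_odd\<close> at the sites \<open>n - 2, \<dots>, 4, 2\<close>, in this order from left to right.
\<close>

definition U_even :: "real \<Rightarrow> real \<Rightarrow> nat \<Rightarrow> real mat" where
  "U_even \<gamma> \<delta> n =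
     foldr (*) (map (\<lambda>j. bulk_at n (2 * j + 1)) [0..<n div 2 - 1]) (right_at \<gamma> \<delta> n)"

definition U_odd :: "real \<Rightarrow> real \<Rightarrow> nat \<Rightarrow> real mat" where
  "U_odd \<alpha> \<beta> n =
     foldr (*) (map (\<lambda>j. bulk_at n (2 * j)) (rev [1..<n div 2])) (left_at \<alpha> \<beta> n)"

definition prob_vec :: "real vec \<Rightarrow> bool" where
  "prob_vec v \<longleftrightarrow> (\<forall>i<dim_vec v. 0 \<le> v $ i) \<and> (\<Sum>i<dim_vec v. v $ i) = 1"

definition steady_state :: "real mat \<Rightarrow> real vec \<Rightarrow> bool" where
  "steady_state M v \<longleftrightarrow> prob_vec v \<and> M *\<^sub>v v = v"

definition normalized :: "real vec \<Rightarrow> real vec" where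
  "normalized v = (1 / (\<Sum>i<dim_vec v. v $ i)) \<cdot>\<^sub>v v"

locale patch =
  fixes \<alpha> \<beta> \<gamma> \<delta> :: real
begin

definition lam :: real where "lam = \<alpha> - \<beta>"
definition mu :: real where "mu = \<gamma> - \<delta>"
definition A :: real where "A = lam * mu + lam - 2"
definition B :: real where "B = lam * mu + mu - 2"

definition x1 :: real where "x1 = (lam + 2) * (mu + 2) / (A * B)"
definition x2 :: real where "x2 = - (A\<^sup>2 / ((lam + 2) * B))"
definition x3 :: real where "x3 = - (B\<^sup>2 / ((mu + 2) * A))"
definition x4 :: real where "x4 = - ((mu + 2) * A / B\<^sup>2)"
definition x5 :: real where "x5 = - ((lam + 2) * B / A\<^sup>2)"
definition x6 :: real where
  "x6 = - (A * ((lam + 1) * mu * (lam + 1 - 2 * \<alpha>) - 2 * (\<alpha> + 1) * lam - 2) / ((lam + 2) * B))"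
definition x7 :: real where "x7 = - ((lam + 1) * A / (lam + 2))"
definition x8 :: real where "x8 = (lam - 1) * (mu + 2) / B"
definition x9 :: real where
  "x9 = A * ((lam + 1) * mu * (lam + 1 - 2 * \<alpha>) - 2 * \<alpha> * lam + 2) / ((lam + 2) * B)"
definition x10 :: real where "x10 = (lam - 1) * A / (lam + 2)"
definition x11 :: real where "x11 = A * B / ((lam + 2) * (mu + 2))"
definition x12 :: real where "x12 = A / B"
definition x13 :: real where "x13 = (lam + 2) * (mu - 1) / B"
definition x14 :: real where "x14 = - ((lam + 2) * (mu + 1) / B)"
definition x15 :: real where "x15 = - ((lam + 2) * (mu + 1) / A)"
definition x16 :: real where "x16 = (lam + 2) * (mu - 1) / A"
definition x17 :: real where
  "x17 = - ((lam + 2) * (lam * (mu + 1) * (mu + 1 - 2 * \<gamma>) - 2 * (\<gamma> + 1) * mu - 2) / (A * B))"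
definition x18 :: real where "x18 = (lam + 2) * (mu + 2) / (A * B)"
definition x19 :: real where
  "x19 = (lam + 2) * (lam * (mu + 1) * (mu + 1 - 2 * \<gamma>) - 2 * \<gamma> * mu + 2) / (A * B)"
definition x20 :: real where "x20 = - ((lam + 2) / A)"
definition x21 :: real where
  "x21 = (lam * (mu + 1) * (mu + 1 - 2 * \<gamma>) - 2 * (\<gamma> + 1) * mu - 2) / B"
definition x22 :: real where
  "x22 = - ((lam * (mu + 1) * (mu + 1 - 2 * \<gamma>) - 2 * \<gamma> * mu + 2) / B)"

fun X :: "bit \<Rightarrow> bit \<Rightarrow> bit \<Rightarrow> bit \<Rightarrow> real" where
  "X 0 0 s s' = 1"
| "X 1 0 s s' = x1"
| "X 0 1 0 s' = x1"
| "X 0 1 1 0 = x2"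
| "X 0 1 1 1 = x4"
| "X 1 1 0 s' = x5"
| "X 1 1 1 0 = 1"
| "X 1 1 1 1 = x1"

fun X' :: "bit \<Rightarrow> bit \<Rightarrow> bit \<Rightarrow> bit \<Rightarrow> real" where
  "X' 0 0 s s' = 1"
| "X' 1 0 s s' = x1"
| "X' 0 1 0 s' = x1"
| "X' 0 1 1 0 = x3"
| "X' 0 1 1 1 = x5"
| "X' 1 1 0 s' = x4"
| "X' 1 1 1 0 = 1"
| "X' 1 1 1 1 = x1"

fun L :: "bit \<Rightarrow> bit \<Rightarrow> bit \<Rightarrow> real" where
  "L 0 0 0 = 1"
| "L 0 0 1 = 1"
| "L 0 1 0 = x7"
| "L 0 1 1 = x6"
| "L 1 0 0 = 1"
| "L 1 0 1 = 1"
| "L 1 1 0 = x10"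
| "L 1 1 1 = x9"

fun L' :: "bit \<Rightarrow> bit \<Rightarrow> bit \<Rightarrow> real" where
  "L' 0 0 0 = 1"
| "L' 0 0 1 = x6"
| "L' 0 1 0 = x7"
| "L' 0 1 1 = 1"
| "L' 1 0 0 = x8"
| "L' 1 0 1 = x9"
| "L' 1 1 0 = x11"
| "L' 1 1 1 = 1"

fun R :: "bit \<Rightarrow> bit \<Rightarrow> bit \<Rightarrow> real" where
  "R 0 0 0 = x12"
| "R 0 0 1 = x13"
| "R 0 1 0 = x14"
| "R 0 1 1 = x12"
| "R 1 0 0 = x17"
| "R 1 0 1 = x19"
| "R 1 1 0 = x20"
| "R 1 1 1 = x20"

fun R' :: "bit \<Rightarrow> bit \<Rightarrow> bit \<Rightarrow> real" where
  "R' 0 0 0 = 1"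
| "R' 0 0 1 = 1"
| "R' 0 1 0 = x15"
| "R' 0 1 1 = x16"
| "R' 1 0 0 = x18"
| "R' 1 0 1 = x18"
| "R' 1 1 0 = x21"
| "R' 1 1 1 = x22"

definition p :: "nat \<Rightarrow> real vec" where
  "p n = vec (2 ^ n) (\<lambda>i. let s = site n i in
     L (s 1) (s 2) (s 3) *
     (\<Prod>j = 1..n div 2 - 2. X (s (2 * j)) (s (2 * j + 1)) (s (2 * j + 2)) (s (2 * j + 3))) *
     R (s (n - 2)) (s (n - 1)) (s n))"

definition p' :: "nat \<Rightarrow> real vec" where
  "p' n = vec (2 ^ n) (\<lambda>i. let s = site n i in
     L' (s 1) (s 2) (s 3) *
     (\<Prod>j = 1..n div 2 - 2. X' (s (2 * j)) (s (2 * j + 1)) (s (2 * j + 2)) (s (2 * j + 3))) *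
     R' (s (n - 2)) (s (n - 1)) (s n))"

end

end

theory Submission
  imports Defs
begin

text \<open>
  For even \<open>n\<close> a half step updates all sites of one parity simultaneously, each as a function of its
  two frozen neighbours (and, at the edge, of a random bit).  The updated product state therefore has
  again one factor per tensor, and it agrees with the other layer's product state up to a gauge:
  there are explicit weights \<open>G\<close> and \<open>H\<close> on three adjacent sites with
  \[ G_{abc}\, X_{\chi(a,b,c)\, c\, \chi(c,d,e)\, e} = X'_{bcde}\, G_{cde}, \qquad
     H_{abc}\, X'_{a\, \chi(a,b,c)\, c\, \chi(c,d,e)} = X_{abcd}\, H_{cde}, \]
  so that the bulk telescopes and only finitely many rational identities at the two edges remain.
\<close>

text \<open>In \<open>chi\<close> the sum \<open>w + e + w * e\<close> is the logical or of the two
  neighbours, so the middle cell flips exactly when some neighbour is 1.\<close>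

lemma chi_simps [simp]:
  "chi a b 1 = b + 1" "chi 1 b c = b + 1" "chi 0 b 0 = b"
  by (cases a; cases b; cases c; simp add: chi_def)+

section \<open>Binary digits of indices and configurations\<close>

lemma site_eq: "site n i k = of_bool (odd (i div 2 ^ (n - k)))"
  using even_of_nat[of "i div 2 ^ (n - k)", where 'a = bit]
  by (cases "of_nat (i div 2 ^ (n - k)) :: bit") (simp_all add: site_def)

text \<open>The number \<open>y * 2 ^ b + l\<close> concatenates the digits of \<open>y\<close> and
  \<open>l\<close>. Division by \<open>2 ^ e\<close> turns the high part into an even summand if
  \<open>e < b\<close>, and drops the low part otherwise.\<close>

lemma odd_div_concat:
  fixes y l b e :: nat
  assumes "l < 2 ^ b"
  shows "odd ((y * 2 ^ b + l) div 2 ^ e) \<longleftrightarrow>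
    (if e < b then odd (l div 2 ^ e) else odd (y div 2 ^ (e - b)))"
proof (cases "e < b")
  case True
  then obtain d where b: "b = e + Suc d"
    using less_imp_Suc_add by auto
  have "(y * 2 ^ b + l) div 2 ^ e = (l + 2 ^ e * (y * 2 ^ Suc d)) div 2 ^ e"
    by (simp add: b power_add ac_simps)
  also have "\<dots> = y * 2 ^ Suc d + l div 2 ^ e"
    by (subst div_mult_self2) auto
  finally show ?thesis using True by simp
next
  case False
  then have e: "(2::nat) ^ e = 2 ^ b * 2 ^ (e - b)"
    by (simp flip: power_add)
  have "(y * 2 ^ b + l) div 2 ^ e = (y * 2 ^ b + l) div 2 ^ b div 2 ^ (e - b)"
    by (simp only: e div_mult2_eq)
  also have "\<dots> = y div 2 ^ (e - b)" using assms by simp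
  finally show ?thesis using False by simp
qed

lemma site_concat:
  assumes "q < 2 ^ m" "l < 2 ^ b" "k \<le> a + m + b"
  shows "site (a + m + b) ((h * 2 ^ m + q) * 2 ^ b + l) k =
    (if k \<le> a then site a h k else if k \<le> a + m then site m q (k - a) else site b l (k - a - m))"
proof -
  define E where "E = a + m + b - k"
  have main: "odd (((h * 2 ^ m + q) * 2 ^ b + l) div 2 ^ E) \<longleftrightarrow>
    (if E < b then odd (l div 2 ^ E) else if E - b < m then odd (q div 2 ^ (E - b))
     else odd (h div 2 ^ (E - b - m)))"
    by (simp only: odd_div_concat[OF assms(1)] odd_div_concat[OF assms(2)])
  \<comment> \<open>Each case names the slack of its comparison by a variable, so that the truncated
    subtractions in the exponents cancel.\<close>
  consider d where "a = k + d" | e d where "k = a + Suc e" "m = Suc e + d"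
    | e d where "k = a + m + Suc e" "b = Suc e + d"
  proof -
    have "(\<exists>d. a = k + d) \<or> (\<exists>e d. k = a + Suc e \<and> m = Suc e + d) \<or>
        (\<exists>e d. k = a + m + Suc e \<and> b = Suc e + d)"
    proof (cases "k \<le> a \<or> a + m < k")
      case True
      then show ?thesis using assms(3) by (metis add.assoc le_iff_add less_iff_Suc_add
          add_Suc_right add_le_cancel_left)
    next
      case False
      then show ?thesis by (metis add.assoc le_iff_add less_iff_Suc_add not_le
          add_Suc_right add_le_cancel_left)
    qed
    then show ?thesis using that by blast
  qed
  then show ?thesis
    unfolding site_eq E_def[symmetric] main unfolding E_def by cases simp_all
qed

text \<open>
  The zero padding outside of \<open>1, \<dots>, n\<close> makes local updates of a configuration
  again equal to the \<open>conf\<close> of an index.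
\<close>

definition conf :: "nat \<Rightarrow> nat \<Rightarrow> nat \<Rightarrow> bit" where
  "conf n i k = (if 1 \<le> k \<and> k \<le> n then site n i k else 0)"

text \<open>With states given by functions of the whole configuration, applying a permutation gate
  becomes a substitution in the argument, and no index arithmetic survives.\<close>

definition vec_of :: "nat \<Rightarrow> ((nat \<Rightarrow> bit) \<Rightarrow> real) \<Rightarrow> real vec" where
  "vec_of n f = vec (2 ^ n) (\<lambda>i. f (conf n i))"

lemma dim_kron [simp]:
  "dim_row (A \<otimes>\<^sub>K B) = dim_row A * dim_row B"
  "dim_col (A \<otimes>\<^sub>K B) = dim_col A * dim_col B"
  by (auto simp: kron_def)

lemma kron_one_left: "1\<^sub>m 1 \<otimes>\<^sub>K M = M"
  by (rule eq_matI) (auto simp: kron_def)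

lemma kron_one_right: "M \<otimes>\<^sub>K 1\<^sub>m 1 = M"
  by (rule eq_matI) (auto simp: kron_def)

subsection \<open>Action of the local operators on configurations\<close>

text \<open>Common shape of all gates: a window of sites with \<open>a\<close> untouched sites to
  its left and \<open>b\<close> to its right. The boundary gates are the cases \<open>a = 0\<close>
  and \<open>b = 0\<close>.\<close>

definition local_op :: "nat \<Rightarrow> nat \<Rightarrow> nat \<Rightarrow> real mat \<Rightarrow> real mat" where
  "local_op a m b M = 1\<^sub>m (2 ^ a) \<otimes>\<^sub>K M \<otimes>\<^sub>K 1\<^sub>m (2 ^ b)"

lemma local_op_carrier:
  assumes "M \<in> carrier_mat (2 ^ m) (2 ^ m)"
  shows "local_op a m b M \<in> carrier_mat (2 ^ (a + m + b)) (2 ^ (a + m + b))"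
  using carrier_matD[OF assms] by (intro carrier_matI) (simp_all add: local_op_def power_add)

text \<open>The two identity factors act as Kronecker deltas on the digits to the left and to the
  right of the window.\<close>

lemma local_op_entry:
  assumes "M \<in> carrier_mat (2 ^ m) (2 ^ m)" "i < 2 ^ (a + m + b)" "j < 2 ^ (a + m + b)"
  shows "local_op a m b M $$ (i, j) =
    (if i div 2 ^ b div 2 ^ m = j div 2 ^ b div 2 ^ m \<and> i mod 2 ^ b = j mod 2 ^ b
     then M $$ (i div 2 ^ b mod 2 ^ m, j div 2 ^ b mod 2 ^ m) else 0)"
proof -
  have "k div 2 ^ b div 2 ^ m < 2 ^ a \<and> k div 2 ^ b < 2 ^ a * 2 ^ m"
    if "k < 2 ^ (a + m + b)" for k :: nat
    using that by (simp add: power_add less_mult_imp_div_less)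
  from this[OF assms(2)] this[OF assms(3)] show ?thesis
    using assms by (simp add: local_op_def kron_def power_add)
qed

text \<open>Row \<open>i\<close> can only be nonzero in the columns that arise from \<open>i\<close>
  by replacing its window digits by some \<open>q\<close>. Below, \<open>J q\<close> is that
  column.\<close>

lemma local_op_mult_vec:
  assumes M: "M \<in> carrier_mat (2 ^ m) (2 ^ m)" and n: "n = a + m + b"
  shows "local_op a m b M *\<^sub>v vec_of n f = vec (2 ^ n) (\<lambda>i. \<Sum>q<2 ^ m.
    M $$ (i div 2 ^ b mod 2 ^ m, q) *
    f (\<lambda>k. if a < k \<and> k \<le> a + m then site m q (k - a) else conf n i k))"
proof (rule eq_vecI)
  note carr = local_op_carrier[OF M, of a b, folded n]
  show "dim_vec (local_op a m b M *\<^sub>v vec_of n f) = dim_vec (vec (2 ^ n) (\<lambda>i. \<Sum>q<2 ^ m.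
    M $$ (i div 2 ^ b mod 2 ^ m, q) *
    f (\<lambda>k. if a < k \<and> k \<le> a + m then site m q (k - a) else conf n i k)))"
    using carr by simp
  fix i assume "i < dim_vec (vec (2 ^ n) (\<lambda>i. \<Sum>q<2 ^ m.
    M $$ (i div 2 ^ b mod 2 ^ m, q) *
    f (\<lambda>k. if a < k \<and> k \<le> a + m then site m q (k - a) else conf n i k)))"
  then have i: "i < 2 ^ n" by simp
  define h where "h = i div 2 ^ b div 2 ^ m"
  define l where "l = i mod 2 ^ b"
  define r where "r = i div 2 ^ b mod 2 ^ m"
  define J where "J = (\<lambda>q. (h * 2 ^ m + q) * 2 ^ b + l)"
  have l: "l < 2 ^ b" and r: "r < 2 ^ m" by (auto simp: l_def r_def)
  have h: "h < 2 ^ a"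
    using i by (simp add: h_def n power_add less_mult_imp_div_less)
  have J_div: "J q div 2 ^ b div 2 ^ m = h" "J q div 2 ^ b mod 2 ^ m = q" "J q mod 2 ^ b = l"
    if "q < 2 ^ m" for q
    using that l by (auto simp: J_def)
  have i_eq: "i = J r"
    by (simp only: J_def h_def l_def r_def div_mult_mod_eq)
  have J_less: "J q < 2 ^ n" if "q < 2 ^ m" for q
  proof -
    have "h * 2 ^ m + q < 2 ^ a * 2 ^ m"
    proof -
      have "h * 2 ^ m + q < Suc h * 2 ^ m" using that by simp
      also have "\<dots> \<le> 2 ^ a * 2 ^ m" using h by (intro mult_right_mono) auto
      finally show ?thesis .
    qed
    then have "Suc (h * 2 ^ m + q) * 2 ^ b \<le> 2 ^ a * 2 ^ m * 2 ^ b"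
      by (intro mult_right_mono) auto
    then show ?thesis using l by (simp add: J_def n power_add)
  qed
  have inj: "inj_on J {..<2 ^ m}"
    by (rule inj_on_inverseI[where g = "\<lambda>j. j div 2 ^ b mod 2 ^ m"]) (simp add: J_div)
  have conf_J: "conf n (J q) = (\<lambda>k. if a < k \<and> k \<le> a + m then site m q (k - a) else conf n i k)"
    if "q < 2 ^ m" for q
    using that l r by (auto simp: fun_eq_iff conf_def i_eq J_def n site_concat)
  have "(local_op a m b M *\<^sub>v vec_of n f) $ i =
      (\<Sum>j<2 ^ n. local_op a m b M $$ (i, j) * f (conf n j))"
    using i carr by (auto simp: vec_of_def scalar_prod_def lessThan_atLeast0 intro!: sum.cong)
  also have "\<dots> = (\<Sum>j\<in>J ` {..<2 ^ m}. local_op a m b M $$ (i, j) * f (conf n j))"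
  \<comment> \<open>A column outside the image of \<open>J\<close> differs from \<open>i\<close> in
    a digit outside the window, where an identity factor vanishes.\<close>
  proof (rule sum.mono_neutral_right)
    show "\<forall>j\<in>{..<2 ^ n} - J ` {..<2 ^ m}. local_op a m b M $$ (i, j) * f (conf n j) = 0"
    proof
      fix j assume j: "j \<in> {..<2 ^ n} - J ` {..<2 ^ m}"
      have "\<not> (h = j div 2 ^ b div 2 ^ m \<and> l = j mod 2 ^ b)"
      proof
        assume *: "h = j div 2 ^ b div 2 ^ m \<and> l = j mod 2 ^ b"
        have "j = J (j div 2 ^ b mod 2 ^ m)"
          using div_mult_mod_eq[of "j div 2 ^ b" "2 ^ m"] div_mult_mod_eq[of j "2 ^ b"]
          by (simp only: J_def conjunct1[OF *] conjunct2[OF *])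
        then show False using j by auto
      qed
      then have "local_op a m b M $$ (i, j) = 0"
        using M i j unfolding n h_def l_def by (subst local_op_entry) auto
      then show "local_op a m b M $$ (i, j) * f (conf n j) = 0" by simp
    qed
  qed (auto simp: J_less)
  also have "\<dots> = (\<Sum>q<2 ^ m. local_op a m b M $$ (i, J q) * f (conf n (J q)))"
    by (simp add: sum.reindex[OF inj])
  also have "\<dots> = (\<Sum>q<2 ^ m. M $$ (r, q) *
      f (\<lambda>k. if a < k \<and> k \<le> a + m then site m q (k - a) else conf n i k))"
  proof (rule sum.cong)
    fix q assume "q \<in> {..<(2::nat) ^ m}"
    then have q: "q < 2 ^ m" by simp
    have "local_op a m b M $$ (i, J q) = M $$ (r, q)"
      using M i J_less[OF q] J_div[OF q] unfolding n
      by (subst local_op_entry) (auto simp: h_def l_def r_def)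
    then show "local_op a m b M $$ (i, J q) * f (conf n (J q)) = M $$ (r, q) *
      f (\<lambda>k. if a < k \<and> k \<le> a + m then site m q (k - a) else conf n i k)"
      by (simp add: conf_J[OF q])
  qed simp
  finally show "(local_op a m b M *\<^sub>v vec_of n f) $ i = vec (2 ^ n) (\<lambda>i. \<Sum>q<2 ^ m.
    M $$ (i div 2 ^ b mod 2 ^ m, q) *
    f (\<lambda>k. if a < k \<and> k \<le> a + m then site m q (k - a) else conf n i k)) $ i"
    using i by (simp add: r_def)
qed

lemma site_local:
  assumes "1 \<le> k" "k \<le> m" "n = a + m + b"
  shows "site m (i div 2 ^ b mod 2 ^ m) k = conf n i (a + k)"
proof -
  have "i = (i div 2 ^ b div 2 ^ m * 2 ^ m + i div 2 ^ b mod 2 ^ m) * 2 ^ b + i mod 2 ^ b"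
    by (simp only: div_mult_mod_eq)
  then have "site n i (a + k) = site (a + m + b)
    ((i div 2 ^ b div 2 ^ m * 2 ^ m + i div 2 ^ b mod 2 ^ m) * 2 ^ b + i mod 2 ^ b) (a + k)"
    using assms by metis
  also have "\<dots> = site m (i div 2 ^ b mod 2 ^ m) k"
    using assms by (subst site_concat) auto
  finally show ?thesis using assms by (simp add: conf_def)
qed

section \<open>The bulk gate as an update of one site\<close>

definition flips :: "nat set \<Rightarrow> (nat \<Rightarrow> bit) \<Rightarrow> nat \<Rightarrow> bit" where
  "flips K s = (\<lambda>k. if k \<in> K then chi (s (k - 1)) (s k) (s (k + 1)) else s k)"

lemma bulk_at_eq: "1 \<le> k \<Longrightarrow> k + 2 \<le> n \<Longrightarrow> bulk_at n k = local_op (k - 1) 3 (n - k - 2) bulk_mat"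
  by (simp add: bulk_at_def local_op_def)

lemma bulk_mat_carrier: "bulk_mat \<in> carrier_mat (2 ^ 3) (2 ^ 3)"
  by (simp add: bulk_mat_def)

lemma lessThan_8: "{..<8::nat} = {0, 1, 2, 3, 4, 5, 6, 7}"
  by auto

lemma lessThan_4: "{..<4::nat} = {0, 1, 2, 3}"
  by auto

text \<open>For fixed neighbours \<open>chi\<close> is an involution in its middle argument. Hence
  the only nonzero column of row \<open>r\<close> is found by applying \<open>chi\<close> to
  \<open>r\<close> itself, with no inverse map.\<close>

lemma bulk_mat_sum:
  assumes "r < 8"
  shows "(\<Sum>q<8. bulk_mat $$ (r, q) * g (site 3 q 1) (site 3 q 2) (site 3 q 3)) =
    g (site 3 r 1) (chi (site 3 r 1) (site 3 r 2) (site 3 r 3)) (site 3 r 3)"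
proof -
  have *: "bulk_mat $$ (r, q) =
      bulk_entry (site 3 r 1, site 3 r 2, site 3 r 3) (site 3 q 1, site 3 q 2, site 3 q 3)"
    if "q < 8" for q
    using assms that by (simp add: bulk_mat_def)
  show ?thesis
    by (cases "site 3 r 1"; cases "site 3 r 2"; cases "site 3 r 3")
      (simp_all add: * lessThan_8 bulk_entry_def site_eq chi_def)
qed

lemma window3: "(\<lambda>k. if a < k \<and> k \<le> a + 3 then c (k - a) else s k) =
    s(a + 1 := c 1, a + 2 := c 2, a + 3 := c 3)" for s :: "nat \<Rightarrow> 'a"
proof
  fix k
  consider "k = a + 1" | "k = a + 2" | "k = a + 3" | "k \<le> a \<or> a + 3 < k" by linarith
  then show "(if a < k \<and> k \<le> a + 3 then c (k - a) else s k) =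
    (s(a + 1 := c 1, a + 2 := c 2, a + 3 := c 3)) k"
    by cases auto
qed

lemma window2: "(\<lambda>k. if a < k \<and> k \<le> a + 2 then c (k - a) else s k) =
    s(a + 1 := c 1, a + 2 := c 2)" for s :: "nat \<Rightarrow> 'a"
proof
  fix k
  consider "k = a + 1" | "k = a + 2" | "k \<le> a \<or> a + 2 < k" by linarith
  then show "(if a < k \<and> k \<le> a + 2 then c (k - a) else s k) = (s(a + 1 := c 1, a + 2 := c 2)) k"
    by cases auto
qed

text \<open>Gates are indexed here by their middle site \<open>k\<close>, the only one that changes,
  rather than by their first site \<open>k - 1\<close>.\<close>

lemma bulk_at_mult_vec:
  assumes "1 < k" "k < n"
  shows "bulk_at n (k - 1) *\<^sub>v vec_of n f = vec_of n (\<lambda>s. f (flips {k} s))"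
proof -
  define a where "a = k - 2"
  have k: "k = a + 2" using assms by (simp add: a_def)
  define b where "b = n - k - 1"
  have n: "n = a + 3 + b" using assms by (simp add: b_def k)
  have "bulk_at n (k - 1) = local_op a 3 b bulk_mat"
    using bulk_at_eq[of "k - 1" n] by (simp add: n k)
  moreover have "(\<Sum>q<2 ^ 3. bulk_mat $$ (i div 2 ^ b mod 2 ^ 3, q) *
      f (\<lambda>k. if a < k \<and> k \<le> a + 3 then site 3 q (k - a) else conf n i k)) =
      f (flips {k} (conf n i))" for i
  proof -
    define s where "s = conf n i"
    define r where "r = i div 2 ^ b mod 2 ^ 3"
    have r: "r < 8" by (simp add: r_def)
    have s: "site 3 r 1 = s (a + 1)" "site 3 r 2 = s (a + 2)" "site 3 r 3 = s (a + 3)"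
      unfolding r_def s_def by (rule site_local; simp add: n)+
    have "flips {k} s =
        s(a + 1 := s (a + 1), a + 2 := chi (s (a + 1)) (s (a + 2)) (s (a + 3)), a + 3 := s (a + 3))"
      by (auto simp: flips_def k fun_eq_iff numeral_3_eq_3)
    then show ?thesis unfolding window3 r_def[symmetric] s_def[symmetric]
      using bulk_mat_sum[OF r, of "\<lambda>x y z. f (s(a + 1 := x, a + 2 := y, a + 3 := z))"]
      by (simp add: s[simplified])
  qed
  ultimately show ?thesis
    by (simp only: local_op_mult_vec[OF bulk_mat_carrier n] vec_of_def[of n "\<lambda>s. f (flips {k} s)"])
qed

section \<open>The stochastic boundary gates\<close>

text \<open>
  The weight for an edge site to go from \<open>t\<close> to \<open>s\<close> next to a site with value \<open>u\<close>: a neighbour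
  \<open>0\<close> lets the averaged virtual site randomize it, a neighbour \<open>1\<close> forces a flip after the
  stochastic step.
\<close>

definition edge_weight :: "real \<Rightarrow> real \<Rightarrow> bit \<Rightarrow> bit \<Rightarrow> bit \<Rightarrow> real" where
  "edge_weight a b u s t =
    (if u = 0 then 1 / 2
     else if t = 0 then (if s = 0 then a else 1 - a) else (if s = 0 then 1 - b else b))"

lemma edge_dims [simp]:
  "dim_row (stoch_mat a b) = 2" "dim_col (stoch_mat a b) = 2"
  "dim_row left_avg_mat = 4" "dim_col left_avg_mat = 4"
  "dim_row right_avg_mat = 4" "dim_col right_avg_mat = 4"
  by (simp_all add: stoch_mat_def left_avg_mat_def right_avg_mat_def mat_of_rows_list_def)

lemma left_mat_carrier: "left_mat \<alpha> \<beta> \<in> carrier_mat (2 ^ 2) (2 ^ 2)"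
  by (intro carrier_matI) (simp_all add: left_mat_def)

lemma right_mat_carrier: "right_mat \<gamma> \<delta> \<in> carrier_mat (2 ^ 2) (2 ^ 2)"
  by (intro carrier_matI) (simp_all add: right_mat_def)

text \<open>Next to a 0, exactly one of the two values of the virtual site produces the required
  edge value, which gives 1/2. Next to a 1, the flip happens for both values.\<close>

lemma left_avg_entry:
  assumes "r < 4" "q < 4"
  shows "left_avg_mat $$ (r, q) = of_bool (site 2 r 2 = site 2 q 2) *
    (if site 2 q 2 = 0 then 1 / 2 else of_bool (site 2 r 1 \<noteq> site 2 q 1))"
  using assms
  by (cases "site 2 r 1"; cases "site 2 q 1"; cases "site 2 r 2"; cases "site 2 q 2")
    (simp_all add: left_avg_mat_def bulk_entry_def chi_def)

lemma right_avg_entry: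
  assumes "r < 4" "q < 4"
  shows "right_avg_mat $$ (r, q) = of_bool (site 2 r 1 = site 2 q 1) *
    (if site 2 q 1 = 0 then 1 / 2 else of_bool (site 2 r 2 \<noteq> site 2 q 2))"
  using assms
  by (cases "site 2 r 1"; cases "site 2 q 1"; cases "site 2 r 2"; cases "site 2 q 2")
    (simp_all add: right_avg_mat_def bulk_entry_def chi_def)

lemma stoch_mat_entry:
  "stoch_mat a b $$ (0, 0) = 1 - a" "stoch_mat a b $$ (0, 1) = b"
  "stoch_mat a b $$ (1, 0) = a" "stoch_mat a b $$ (1, 1) = 1 - b"
  by (simp_all add: stoch_mat_def mat_of_rows_list_def)

lemma site2:
  "site 2 0 k = 0" "site 2 (Suc 0) (Suc 0) = 0" "site 2 (Suc 0) 2 = 1"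
  "site 2 2 (Suc 0) = 1" "site 2 2 2 = 0" "site 2 3 (Suc 0) = 1" "site 2 3 2 = 1"
  by (simp_all add: site_eq)

text \<open>Next to a 0 the averaging erases the outcome of the stochastic step, and the columns of
  \<open>stoch_mat\<close> sum to 1. Next to a 1 the flip selects the row of
  \<open>stoch_mat\<close> opposite to the final edge value.\<close>

lemma left_mat_entry:
  assumes "r < 4" "q < 4"
  shows "left_mat \<alpha> \<beta> $$ (r, q) =
    (if site 2 r 2 = site 2 q 2 then edge_weight \<alpha> \<beta> (site 2 r 2) (site 2 r 1) (site 2 q 1) else 0)"
proof -
  have "left_mat \<alpha> \<beta> $$ (r, q) = (\<Sum>k<4. left_avg_mat $$ (r, k) *
      (stoch_mat \<alpha> \<beta> $$ (k div 2, q div 2) * of_bool (k mod 2 = q mod 2)))"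
    using assms by (simp add: left_mat_def scalar_prod_def kron_def lessThan_atLeast0 of_bool_def)
  then have "left_mat \<alpha> \<beta> $$ (r, q) = (\<Sum>k<4. of_bool (site 2 r 2 = site 2 k 2) *
    (if site 2 k 2 = 0 then 1 / 2 else of_bool (site 2 r 1 \<noteq> site 2 k 1)) *
      (stoch_mat \<alpha> \<beta> $$ (k div 2, q div 2) * of_bool (k mod 2 = q mod 2)))"
    using assms by (simp add: left_avg_entry)
  moreover have "r = 0 \<or> r = 1 \<or> r = 2 \<or> r = 3" "q = 0 \<or> q = 1 \<or> q = 2 \<or> q = 3"
    using assms by auto
  ultimately show ?thesis
    by (elim disjE; simp add: lessThan_4 site2 edge_weight_def stoch_mat_entry[simplified]
        add_divide_distrib diff_divide_distrib)
qed

lemma right_mat_entry: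
  assumes "r < 4" "q < 4"
  shows "right_mat \<gamma> \<delta> $$ (r, q) =
    (if site 2 r 1 = site 2 q 1 then edge_weight \<gamma> \<delta> (site 2 r 1) (site 2 r 2) (site 2 q 2) else 0)"
proof -
  have "right_mat \<gamma> \<delta> $$ (r, q) = (\<Sum>k<4. right_avg_mat $$ (r, k) *
      (of_bool (k div 2 = q div 2) * stoch_mat \<gamma> \<delta> $$ (k mod 2, q mod 2)))"
    using assms by (simp add: right_mat_def scalar_prod_def kron_def lessThan_atLeast0 of_bool_def)
  then have "right_mat \<gamma> \<delta> $$ (r, q) = (\<Sum>k<4. of_bool (site 2 r 1 = site 2 k 1) *
    (if site 2 k 1 = 0 then 1 / 2 else of_bool (site 2 r 2 \<noteq> site 2 k 2)) *
      (of_bool (k div 2 = q div 2) * stoch_mat \<gamma> \<delta> $$ (k mod 2, q mod 2)))"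
    using assms by (simp add: right_avg_entry)
  moreover have "r = 0 \<or> r = 1 \<or> r = 2 \<or> r = 3" "q = 0 \<or> q = 1 \<or> q = 2 \<or> q = 3"
    using assms by auto
  ultimately show ?thesis
    by (elim disjE; simp add: lessThan_4 site2 edge_weight_def stoch_mat_entry[simplified]
        add_divide_distrib diff_divide_distrib)
qed

lemma left_mat_sum:
  assumes "r < 4"
  shows "(\<Sum>q<4. left_mat \<alpha> \<beta> $$ (r, q) * g (site 2 q 1) (site 2 q 2)) =
    edge_weight \<alpha> \<beta> (site 2 r 2) (site 2 r 1) 0 * g 0 (site 2 r 2) +
    edge_weight \<alpha> \<beta> (site 2 r 2) (site 2 r 1) 1 * g 1 (site 2 r 2)"
  using assms
  by (cases "site 2 r 2") (simp_all add: lessThan_4 left_mat_entry site_eq)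

lemma right_mat_sum:
  assumes "r < 4"
  shows "(\<Sum>q<4. right_mat \<alpha> \<beta> $$ (r, q) * g (site 2 q 1) (site 2 q 2)) =
    edge_weight \<alpha> \<beta> (site 2 r 1) (site 2 r 2) 0 * g (site 2 r 1) 0 +
    edge_weight \<alpha> \<beta> (site 2 r 1) (site 2 r 2) 1 * g (site 2 r 1) 1"
  using assms
  by (cases "site 2 r 1") (simp_all add: lessThan_4 right_mat_entry site_eq)

lemma left_at_mult_vec:
  assumes n: "2 \<le> n"
  shows "left_at \<alpha> \<beta> n *\<^sub>v vec_of n f = vec_of n (\<lambda>s.
    edge_weight \<alpha> \<beta> (s 2) (s 1) 0 * f (s(1 := 0)) + edge_weight \<alpha> \<beta> (s 2) (s 1) 1 * f (s(1 := 1)))"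
    (is "_ = vec_of n ?g")
proof -
  define b where "b = n - 2"
  have n: "n = 0 + 2 + b" using assms by (simp add: b_def)
  have "left_at \<alpha> \<beta> n = local_op 0 2 b (left_mat \<alpha> \<beta>)"
    unfolding left_at_def local_op_def by (simp add: kron_one_left[simplified] b_def)
  moreover have "(\<Sum>q<2 ^ 2. left_mat \<alpha> \<beta> $$ (i div 2 ^ b mod 2 ^ 2, q) *
      f (\<lambda>k. if 0 < k \<and> k \<le> 0 + 2 then site 2 q (k - 0) else conf n i k)) = ?g (conf n i)" for i
  proof -
    define s where "s = conf n i"
    define r where "r = i div 2 ^ b mod 2 ^ 2"
    have r: "r < 4" by (simp add: r_def)
    have s: "site 2 r 1 = s (0 + 1)" "site 2 r 2 = s (0 + 2)"
      unfolding r_def s_def by (rule site_local; simp add: n)+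
    \<comment> \<open>The inner site is overwritten by its own value to match the two-site shape of
      \<open>window2\<close>.\<close>
    have upd: "s(1 := x) = s(0 + 1 := x, 0 + 2 := s (0 + 2))" for x
      by (auto simp: fun_eq_iff)
    show ?thesis unfolding window2 r_def[symmetric] s_def[symmetric] upd
      using left_mat_sum[OF r, of \<alpha> \<beta> "\<lambda>x y. f (s(0 + 1 := x, 0 + 2 := y))"] s
      by (simp del: add_2_eq_Suc')
  qed
  ultimately show ?thesis
    by (simp only: local_op_mult_vec[OF left_mat_carrier n] vec_of_def[of n ?g])
qed

lemma right_at_mult_vec:
  assumes n: "2 \<le> n"
  shows "right_at \<gamma> \<delta> n *\<^sub>v vec_of n f = vec_of n (\<lambda>s.
    edge_weight \<gamma> \<delta> (s (n - 1)) (s n) 0 * f (s(n := 0)) +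
    edge_weight \<gamma> \<delta> (s (n - 1)) (s n) 1 * f (s(n := 1)))"
    (is "_ = vec_of n ?g")
proof -
  define a where "a = n - 2"
  have n: "n = a + 2 + 0" using assms by (simp add: a_def)
  have "right_at \<gamma> \<delta> n = local_op a 2 0 (right_mat \<gamma> \<delta>)"
    unfolding right_at_def local_op_def by (simp add: kron_one_right[simplified] a_def)
  moreover have "(\<Sum>q<2 ^ 2. right_mat \<gamma> \<delta> $$ (i div 2 ^ 0 mod 2 ^ 2, q) *
      f (\<lambda>k. if a < k \<and> k \<le> a + 2 then site 2 q (k - a) else conf n i k)) = ?g (conf n i)" for i
  proof -
    define s where "s = conf n i"
    define r where "r = i div 2 ^ 0 mod 2 ^ 2"
    have r: "r < 4" by (simp add: r_def)
    have s: "site 2 r 1 = s (a + 1)" "site 2 r 2 = s (a + 2)"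
      unfolding r_def s_def by (rule site_local; simp add: n)+
    have upd: "s(a + 2 := x) = s(a + 1 := s (a + 1), a + 2 := x)" for x
      by (auto simp: fun_eq_iff)
    have n1: "n - 1 = a + 1" "n = a + 2" using n by auto
    show ?thesis unfolding window2 r_def[symmetric] s_def[symmetric] unfolding n1 upd
      using right_mat_sum[OF r, of \<gamma> \<delta> "\<lambda>x y. f (s(a + 1 := x, a + 2 := y))"] s
      by simp
  qed
  ultimately show ?thesis
    by (simp only: local_op_mult_vec[OF right_mat_carrier n] vec_of_def[of n ?g])
qed

section \<open>Half-step propagators as simultaneous updates\<close>

lemma bulk_at_carrier:
  assumes "1 < k" "k < n"
  shows "bulk_at n (k - 1) \<in> carrier_mat (2 ^ n) (2 ^ n)"
proof -
  have "bulk_at n (k - 1) = local_op (k - 2) 3 (n - k - 1) bulk_mat"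
    using assms bulk_at_eq[of "k - 1" n] by (simp add: numeral_2_eq_2)
  moreover have "k - 2 + 3 + (n - k - 1) = n" using assms by simp
  ultimately show ?thesis using local_op_carrier[OF bulk_mat_carrier] by metis
qed

lemma pow2_split: "2 \<le> n \<Longrightarrow> (2::nat) ^ n = 4 * 2 ^ (n - 2)"
  using power_add[of "2::nat" 2 "n - 2"] by (simp del: add_2_eq_Suc add_2_eq_Suc' power_Suc)

lemma left_at_carrier: "2 \<le> n \<Longrightarrow> left_at \<alpha> \<beta> n \<in> carrier_mat (2 ^ n) (2 ^ n)"
  using carrier_matD[OF left_mat_carrier[of \<alpha> \<beta>]]
  by (intro carrier_matI) (simp_all add: left_at_def pow2_split)

lemma right_at_carrier: "2 \<le> n \<Longrightarrow> right_at \<gamma> \<delta> n \<in> carrier_mat (2 ^ n) (2 ^ n)"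
  using carrier_matD[OF right_mat_carrier[of \<gamma> \<delta>]]
  by (intro carrier_matI) (simp_all add: right_at_def pow2_split)

text \<open>Updates at sites of equal parity do not read each other's results, so a layer acts simultaneously.\<close>

lemma bulk_layer:
  assumes "M \<in> carrier_mat (2 ^ n) (2 ^ n)" "v \<in> carrier_vec (2 ^ n)"
    and "M *\<^sub>v v = vec_of n f"
    and "distinct ks" "\<forall>k\<in>set ks. 1 < k \<and> k < n \<and> even (k + c)"
  shows "foldr (*) (map (\<lambda>k. bulk_at n (k - 1)) ks) M \<in> carrier_mat (2 ^ n) (2 ^ n) \<and>
    foldr (*) (map (\<lambda>k. bulk_at n (k - 1)) ks) M *\<^sub>v v = vec_of n (\<lambda>s. f (flips (set ks) s))"
  using assms(4,5)
proof (induction ks)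
  case Nil
  then show ?case using assms by (simp add: flips_def)
next
  case (Cons k ks)
  define F where "F = foldr (*) (map (\<lambda>k. bulk_at n (k - 1)) ks) M"
  have F: "F \<in> carrier_mat (2 ^ n) (2 ^ n)" "F *\<^sub>v v = vec_of n (\<lambda>s. f (flips (set ks) s))"
    using Cons by (auto simp: F_def)
  have k: "1 < k" "k < n" using Cons.prems by auto
  \<comment> \<open>The leftmost gate acts last on the vector, hence first on the configuration.
    Since \<open>1 < j\<close>, the subtraction in \<open>j - 1\<close> is not truncated, and both
    neighbours of \<open>j\<close> have the parity opposite to \<open>k\<close>.\<close>
  have "flips (set ks) (flips {k} s) = flips (set (k # ks)) s" for s
  proof
    fix j
    have "j - 1 \<noteq> k" "j + 1 \<noteq> k" "j \<noteq> k" if "j \<in> set ks"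
    proof -
      have "1 < j" "even (j + c)" "even (k + c)" using Cons.prems that by auto
      then show "j - 1 \<noteq> k" "j + 1 \<noteq> k" by presburger+
      show "j \<noteq> k" using Cons.prems that by auto
    qed
    then show "flips (set ks) (flips {k} s) j = flips (set (k # ks)) s j"
      by (auto simp: flips_def)
  qed
  then have "(bulk_at n (k - 1) * F) *\<^sub>v v = vec_of n (\<lambda>s. f (flips (set (k # ks)) s))"
    by (simp only: assoc_mult_mat_vec[OF bulk_at_carrier[OF k] F(1) assms(2)] F(2) bulk_at_mult_vec[OF k])
  then show ?case
    using mult_carrier_mat[OF bulk_at_carrier[OF k] F(1)] by (simp add: F_def)
qed

text \<open>The boundary gate is the rightmost factor, so its edge sum is evaluated at the already
  flipped configuration \<open>u\<close>. Site \<open>n\<close> itself is not flipped.\<close>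

lemma U_even_mult_vec:
  assumes "even n" "4 \<le> n"
  shows "U_even \<gamma> \<delta> n \<in> carrier_mat (2 ^ n) (2 ^ n)"
    and "U_even \<gamma> \<delta> n *\<^sub>v vec_of n f = vec_of n (\<lambda>s. let u = flips {k. even k \<and> 1 < k \<and> k < n} s in
      edge_weight \<gamma> \<delta> (u (n - 1)) (u n) 0 * f (u(n := 0)) +
      edge_weight \<gamma> \<delta> (u (n - 1)) (u n) 1 * f (u(n := 1)))"
proof -
  \<comment> \<open>The gate starting at site \<open>2 * j + 1\<close> is renamed by its middle
    site.\<close>
  define ks where "ks = map (\<lambda>j. 2 * j + 2) [0..<n div 2 - 1]"
  have set_ks: "set ks = {k. even k \<and> 1 < k \<and> k < n}"
  proof (rule Set.set_eqI, rule iffI)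
    fix k assume "k \<in> {k. even k \<and> 1 < k \<and> k < n}"
    then have "k = 2 * (k div 2 - 1) + 2" "k div 2 - 1 < n div 2 - 1"
      using assms by (auto elim!: evenE)
    then show "k \<in> set ks" unfolding ks_def by force
  qed (use assms in \<open>auto simp: ks_def\<close>)
  have ks: "distinct ks" "\<forall>k\<in>set ks. 1 < k \<and> k < n \<and> even (k + 0)"
    unfolding set_ks by (auto simp: ks_def distinct_map inj_on_def)
  have U: "U_even \<gamma> \<delta> n = foldr (*) (map (\<lambda>k. bulk_at n (k - 1)) ks) (right_at \<gamma> \<delta> n)"
    by (simp add: U_even_def ks_def comp_def)
  have n: "2 \<le> n" using assms by simp
  have v: "vec_of n f \<in> carrier_vec (2 ^ n)" for f by (simp add: vec_of_def)
  have *: "foldr (*) (map (\<lambda>k. bulk_at n (k - 1)) ks) (right_at \<gamma> \<delta> n) \<in> carrier_mat (2 ^ n) (2 ^ n) \<and>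
    foldr (*) (map (\<lambda>k. bulk_at n (k - 1)) ks) (right_at \<gamma> \<delta> n) *\<^sub>v vec_of n f =
    vec_of n (\<lambda>s. let u = flips {k. even k \<and> 1 < k \<and> k < n} s in
      edge_weight \<gamma> \<delta> (u (n - 1)) (u n) 0 * f (u(n := 0)) +
      edge_weight \<gamma> \<delta> (u (n - 1)) (u n) 1 * f (u(n := 1)))" for f
    unfolding Let_def set_ks[symmetric]
    by (rule bulk_layer[OF right_at_carrier[OF n] v right_at_mult_vec[OF n] ks])
  show "U_even \<gamma> \<delta> n \<in> carrier_mat (2 ^ n) (2 ^ n)"
    using * unfolding U by blast
  show "U_even \<gamma> \<delta> n *\<^sub>v vec_of n f = vec_of n (\<lambda>s. let u = flips {k. even k \<and> 1 < k \<and> k < n} s in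
      edge_weight \<gamma> \<delta> (u (n - 1)) (u n) 0 * f (u(n := 0)) +
      edge_weight \<gamma> \<delta> (u (n - 1)) (u n) 1 * f (u(n := 1)))"
    using * unfolding U by blast
qed

lemma U_odd_mult_vec:
  assumes "even n" "4 \<le> n"
  shows "U_odd \<alpha> \<beta> n \<in> carrier_mat (2 ^ n) (2 ^ n)"
    and "U_odd \<alpha> \<beta> n *\<^sub>v vec_of n f = vec_of n (\<lambda>s. let u = flips {k. odd k \<and> 1 < k \<and> k < n} s in
      edge_weight \<alpha> \<beta> (u 2) (u 1) 0 * f (u(1 := 0)) + edge_weight \<alpha> \<beta> (u 2) (u 1) 1 * f (u(1 := 1)))"
proof -
  \<comment> \<open>Middle sites again, in the decreasing order in which \<open>U_odd\<close> lists
    its gates.\<close>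
  define ks where "ks = map (\<lambda>j. 2 * j + 1) (rev [1..<n div 2])"
  have set_ks: "set ks = {k. odd k \<and> 1 < k \<and> k < n}"
  proof (rule Set.set_eqI, rule iffI)
    fix k assume "k \<in> {k. odd k \<and> 1 < k \<and> k < n}"
    then have "k = 2 * (k div 2) + 1" "1 \<le> k div 2" "k div 2 < n div 2"
      using assms by (auto elim!: oddE evenE)
    then show "k \<in> set ks" unfolding ks_def by force
  qed (use assms in \<open>auto simp: ks_def\<close>)
  have ks: "distinct ks" "\<forall>k\<in>set ks. 1 < k \<and> k < n \<and> even (k + 1)"
    unfolding set_ks by (auto simp: ks_def distinct_map inj_on_def)
  have U: "U_odd \<alpha> \<beta> n = foldr (*) (map (\<lambda>k. bulk_at n (k - 1)) ks) (left_at \<alpha> \<beta> n)"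
    by (simp add: U_odd_def ks_def comp_def)
  have n: "2 \<le> n" using assms by simp
  have v: "vec_of n f \<in> carrier_vec (2 ^ n)" for f by (simp add: vec_of_def)
  have *: "foldr (*) (map (\<lambda>k. bulk_at n (k - 1)) ks) (left_at \<alpha> \<beta> n) \<in> carrier_mat (2 ^ n) (2 ^ n) \<and>
    foldr (*) (map (\<lambda>k. bulk_at n (k - 1)) ks) (left_at \<alpha> \<beta> n) *\<^sub>v vec_of n f =
    vec_of n (\<lambda>s. let u = flips {k. odd k \<and> 1 < k \<and> k < n} s in
      edge_weight \<alpha> \<beta> (u 2) (u 1) 0 * f (u(1 := 0)) + edge_weight \<alpha> \<beta> (u 2) (u 1) 1 * f (u(1 := 1)))" for f
    unfolding Let_def set_ks[symmetric]
    by (rule bulk_layer[OF left_at_carrier[OF n] v left_at_mult_vec[OF n] ks])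
  show "U_odd \<alpha> \<beta> n \<in> carrier_mat (2 ^ n) (2 ^ n)"
    using * unfolding U by blast
  show "U_odd \<alpha> \<beta> n *\<^sub>v vec_of n f = vec_of n (\<lambda>s. let u = flips {k. odd k \<and> 1 < k \<and> k < n} s in
      edge_weight \<alpha> \<beta> (u 2) (u 1) 0 * f (u(1 := 0)) + edge_weight \<alpha> \<beta> (u 2) (u 1) 1 * f (u(1 := 1)))"
    using * unfolding U by blast
qed

text \<open>Strict positivity makes the normalizing sum nonzero, and the scalar passes through
  \<open>M\<close> by linearity.\<close>

lemma steady_state_normalized:
  assumes "M *\<^sub>v v = v" "M \<in> carrier_mat (dim_vec v) (dim_vec v)"
    and "\<And>i. i < dim_vec v \<Longrightarrow> 0 < v $ i" "0 < dim_vec v"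
  shows "steady_state M (normalized v)"
proof -
  have "0 < (\<Sum>i<dim_vec v. v $ i)"
    using assms(3,4) by (intro sum_pos) auto
  then have "prob_vec (normalized v)"
    using assms(3) by (simp add: prob_vec_def normalized_def less_imp_le flip: sum_divide_distrib)
  moreover have "M *\<^sub>v normalized v = normalized v"
    using assms(1,2) unfolding normalized_def
    by (subst mult_mat_vec[of _ "dim_vec v" "dim_vec v"]) auto
  ultimately show ?thesis by (simp add: steady_state_def)
qed

subsection \<open>Positivity and local relations of the tensors\<close>

text \<open>An affine function of \<open>m\<close> that is nonnegative at -1 and 1 and positive at 0
  is positive on the open interval.\<close>

lemma affine_pos:
  fixes u v m :: real
  assumes "\<bar>m\<bar> < 1" "\<bar>v\<bar> \<le> u" "0 < u"
  shows "0 < u + v * m"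
proof -
  have "\<bar>v * m\<bar> \<le> u * \<bar>m\<bar>"
    using assms by (simp add: abs_mult mult_right_mono)
  also have "\<dots> < u * 1"
    using assms by (intro mult_strict_left_mono) auto
  finally show ?thesis by linarith
qed

text \<open>This is the bracket in \<open>x6\<close> and, with left and right parameters exchanged,
  in \<open>x17\<close> and \<open>x21\<close>. It is affine in \<open>m\<close>, so the endpoints
  decide its sign.\<close>

lemma edge_factor_neg:
  fixes a b m :: real
  assumes a: "0 < a" "a < 1" and b: "0 < b" "b < 1" and m: "\<bar>m\<bar> < 1"
  shows "(a - b + 1) * m * (a - b + 1 - 2 * a) - 2 * (a + 1) * (a - b) - 2 < 0"
proof -
  define u where "u = 2 + 2 * (a + 1) * (a - b)"
  define v where "v = - ((a - b + 1) * (a - b + 1 - 2 * a))"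
  \<comment> \<open>The values of the negated bracket at \<open>m = 1\<close> and
    \<open>m = -1\<close>, arranged as sums of terms that are positive for rates between 0 and
    1.\<close>
  have "u + v = (1 - b) * (1 + b) + 2 * a * (1 - b) + 3 * a * a"
    "u - v = (1 - b) * (3 - b) + a * a + 2 * a * (1 - b)"
    by (simp_all add: u_def v_def algebra_simps)
  moreover have "0 < (1 - b) * (1 + b)" "0 < (1 - b) * (3 - b)" "0 < a * (1 - b)" "0 < a * a"
    using a b by simp_all
  ultimately have "0 < u + v" "0 < u - v" by linarith+
  then have "0 < u + v * m" by (intro affine_pos m) auto
  then show ?thesis by (simp add: u_def v_def algebra_simps)
qed

text \<open>The bracket in \<open>x9\<close> and, after the same exchange, in \<open>x19\<close> and
  \<open>x22\<close>, treated in the same way.\<close>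

lemma edge_factor_pos:
  fixes a b m :: real
  assumes a: "0 < a" "a < 1" and b: "0 < b" "b < 1" and m: "\<bar>m\<bar> < 1"
  shows "0 < (a - b + 1) * m * (a - b + 1 - 2 * a) - 2 * a * (a - b) + 2"
proof -
  define u where "u = 2 - 2 * a * (a - b)"
  define v where "v = (a - b + 1) * (a - b + 1 - 2 * a)"
  have "u + v = (1 - a) * (1 + 3 * a) + 2 * (1 - a) * (1 - b) + b * b"
    "u - v = (1 - a) * (1 + a) + 2 * (a * b) + b * (1 - b) + b"
    by (simp_all add: u_def v_def algebra_simps)
  moreover have "0 < (1 - a) * (1 + 3 * a)" "0 < (1 - a) * (1 - b)" "0 < (1 - a) * (1 + a)"
    "0 < a * b" "0 < b * (1 - b)" "0 < b * b"
    using a b by simp_all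
  ultimately have "0 < u + v" "0 < u - v" using b by linarith+
  then have "0 < u + v * m" by (intro affine_pos m) auto
  then show ?thesis by (simp add: u_def v_def algebra_simps)
qed

text \<open>The weight \<open>g\<close> is pushed through the product from left to right and turns
  each \<open>x j\<close> it passes into \<open>y j\<close>.\<close>

lemma prod_telescope:
  fixes g x y :: "nat \<Rightarrow> 'a :: comm_ring_1"
  assumes "l = r * g 0" "\<And>j. g j * x (Suc j) = y (Suc j) * g (Suc j)"
  shows "l * (\<Prod>j = 1..m. x j) = r * (\<Prod>j = 1..m. y j) * g m"
proof (induction m)
  case (Suc m)
  have "l * (\<Prod>j = 1..Suc m. x j) = r * (\<Prod>j = 1..m. y j) * (g m * x (Suc m))"
    using Suc.IH by (simp add: mult.assoc [symmetric])
  then show ?case by (simp add: assms(2) ac_simps)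
qed (simp add: assms(1))

context patch
begin

lemmas x_defs = x1_def x2_def x3_def x4_def x5_def x6_def x7_def x8_def x9_def x10_def x11_def
  x12_def x13_def x14_def x15_def x16_def x17_def x18_def x19_def x20_def x21_def x22_def

text \<open>\<open>G a b c\<close> is the ratio \<open>L a (chi a b c) c / L' a b c\<close>.\<close>

fun G :: "bit \<Rightarrow> bit \<Rightarrow> bit \<Rightarrow> real" where
  "G 0 s s' = 1"
| "G 1 0 0 = 1 / x1"
| "G 1 0 1 = 1"
| "G 1 1 0 = x1"
| "G 1 1 1 = 1"

end

locale patch_open = patch +
  assumes rates: "0 < \<alpha>" "\<alpha> < 1" "0 < \<beta>" "\<beta> < 1" "0 < \<gamma>" "\<gamma> < 1" "0 < \<delta>" "\<delta> < 1"
begin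

lemma lam_bounds: "\<bar>lam\<bar> < 1" "-1 < lam" "lam < 1" and mu_bounds: "\<bar>mu\<bar> < 1" "-1 < mu" "mu < 1"
  using rates by (auto simp: lam_def mu_def)

text \<open>Here \<open>- A = 2 - (mu + 1) * lam\<close> is affine in \<open>lam\<close>, with
  \<open>mu + 1\<close> between 0 and 2.\<close>

lemma A_neg: "A < 0"
  using affine_pos[OF lam_bounds(1), of "- (mu + 1)" 2] mu_bounds
  by (simp add: A_def algebra_simps)

lemma B_neg: "B < 0"
  using affine_pos[OF mu_bounds(1), of "- (lam + 1)" 2] lam_bounds
  by (simp add: B_def algebra_simps)

lemma edge_factors:
  "(lam + 1) * mu * (lam + 1 - 2 * \<alpha>) - 2 * (\<alpha> + 1) * lam - 2 < 0"
  "0 < (lam + 1) * mu * (lam + 1 - 2 * \<alpha>) - 2 * \<alpha> * lam + 2"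
  "lam * (mu + 1) * (mu + 1 - 2 * \<gamma>) - 2 * (\<gamma> + 1) * mu - 2 < 0"
  "0 < lam * (mu + 1) * (mu + 1 - 2 * \<gamma>) - 2 * \<gamma> * mu + 2"
  using edge_factor_neg[of \<alpha> \<beta> mu] edge_factor_pos[of \<alpha> \<beta> mu]
    edge_factor_neg[of \<gamma> \<delta> lam] edge_factor_pos[of \<gamma> \<delta> lam] rates lam_bounds mu_bounds
  by (simp_all add: lam_def[symmetric] mu_def[symmetric] mult.commute[of lam])

text \<open>After \<open>edge_factors\<close>, every factor in the definitions has a known sign, so
  only signs have to be counted.\<close>

lemma x_pos:
  "0 < x1" "0 < x2" "0 < x3" "0 < x4" "0 < x5" "0 < x6" "0 < x7" "0 < x8" "0 < x9" "0 < x10"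
  "0 < x11" "0 < x12" "0 < x13" "0 < x14" "0 < x15" "0 < x16" "0 < x17" "0 < x18" "0 < x19"
  "0 < x20" "0 < x21" "0 < x22"
  using A_neg B_neg lam_bounds mu_bounds edge_factors
  unfolding x_defs
  by (auto simp: zero_less_divide_iff zero_less_mult_iff divide_less_0_iff mult_less_0_iff)

lemma tensors_pos: "0 < X a b c d" "0 < X' a b c d" "0 < L a b c" "0 < L' a b c" "0 < R a b c" "0 < R' a b c"
  by (cases a; cases b; cases c; cases d; simp add: x_pos)+

lemma nonzero: "A \<noteq> 0" "B \<noteq> 0" "lam + 2 \<noteq> 0" "mu + 2 \<noteq> 0" "lam - 1 \<noteq> 0"
  using A_neg B_neg lam_bounds mu_bounds by auto

section \<open>Gauge relations in the bulk and at the edges\<close>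

lemma G_left: "L a (chi a b c) c = L' a b c * G a b c"
  using nonzero by (cases a; cases b; cases c; simp add: x_defs divide_simps)

text \<open>Only 1 and \<open>x1\<close> to \<open>x5\<close> occur, which up to sign are monomials
  in \<open>A\<close>, \<open>B\<close>, \<open>lam + 2\<close>, \<open>mu + 2\<close> and their
  inverses. All cases therefore hold without unfolding \<open>A\<close> and
  \<open>B\<close>.\<close>

lemma G_bulk: "G a b c * X (chi a b c) c (chi c d e) e = X' b c d e * G c d e"
  using nonzero
  by (cases a; cases b; cases c; cases d; cases e; simp add: x_defs divide_simps power2_eq_square)

text \<open>With \<delta> eliminated as \<open>\<gamma> - mu\<close>, clearing denominators leaves
  polynomial identities in \<open>lam\<close>, \<open>mu\<close> and \<gamma>. Unlike the bulk
  relations, some of them need the definitions of \<open>A\<close> and \<open>B\<close>.\<close>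

lemma right_identities_mu:
  "x12 + x13 = 2" "x17 + x19 = 2 * x1" "(1 + mu) * x20 = x15" "(1 - mu) * x20 = x16"
  "\<gamma> * x14 + (1 - \<gamma> + mu) * x12 = x21" "(1 - \<gamma>) * x14 + (\<gamma> - mu) * x12 = x22"
  by (simp add: x_defs divide_simps nonzero, simp add: A_def B_def algebra_simps)+

lemma right_identities:
  "\<gamma> * x20 + (1 - \<delta>) * x20 = x15" "(1 - \<gamma>) * x20 + \<delta> * x20 = x16"
  "\<gamma> * x14 + (1 - \<delta>) * x12 = x21" "(1 - \<gamma>) * x14 + \<delta> * x12 = x22"
  using right_identities_mu(3-6) by (simp_all add: mu_def algebra_simps)

lemma left_identities_lam:
  "1 + x8 = 2 * x12" "x6 + x9 = 2 * x12" "1 + lam = x7 * x20" "1 - lam = x10 * x20"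
  "\<alpha> * x7 + (1 - \<alpha> + lam) * x11 = x6 * x20 / x1"
  "(1 - \<alpha>) * x7 + (\<alpha> - lam) * x11 = x9 * x20 / x1"
  by (simp add: x_defs divide_simps nonzero, (simp add: A_def B_def algebra_simps)?)+

lemma left_identities:
  "\<alpha> + 1 - \<beta> = x7 * x20" "1 - \<alpha> + \<beta> = x10 * x20"
  "\<alpha> * x7 + (1 - \<beta>) * x11 = x6 * x20 / x1" "(1 - \<alpha>) * x7 + \<beta> * x11 = x9 * x20 / x1"
proof -
  have "\<alpha> + 1 - \<beta> = 1 + lam" "1 - \<alpha> + \<beta> = 1 - lam" "1 - \<beta> = 1 - \<alpha> + lam" "\<beta> = \<alpha> - lam"
    by (simp_all add: lam_def)
  then show "\<alpha> + 1 - \<beta> = x7 * x20" "1 - \<alpha> + \<beta> = x10 * x20"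
    "\<alpha> * x7 + (1 - \<beta>) * x11 = x6 * x20 / x1" "(1 - \<alpha>) * x7 + \<beta> * x11 = x9 * x20 / x1"
    using left_identities_lam(3-6) by metis+
qed

lemma x18_eq: "x18 = x1"
  by (simp add: x1_def x18_def)

text \<open>The shift \<open>a + 1\<close> for \<open>c = 1\<close> undoes the flip
  \<open>chi a b 1 = b + 1\<close> that \<open>G_right\<close> substitutes for the first argument of
  \<open>R\<close>.\<close>

lemma right_average: "edge_weight \<gamma> \<delta> c d 0 * R a c 0 + edge_weight \<gamma> \<delta> c d 1 * R a c 1 =
    (if c = 0 then if a = 0 then 1 else x1 else R' (a + 1) 1 d)"
  using right_identities right_identities_mu(1,2)
  by (cases a; cases c; cases d; simp add: edge_weight_def;
      (algebra | simp add: algebra_simps))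

lemma G_right: "G a b c * (edge_weight \<gamma> \<delta> c d 0 * R (chi a b c) c 0 +
    edge_weight \<gamma> \<delta> c d 1 * R (chi a b c) c 1) = R' b c d"
  unfolding right_average using x_pos(1)
  by (cases a; cases b; cases c; cases d; simp add: x18_eq chi_def)

text \<open>\<open>H a b c\<close> is the ratio \<open>R a b c / R' a (chi a b c) c\<close>.\<close>

definition H :: "bit \<Rightarrow> bit \<Rightarrow> bit \<Rightarrow> real" where
  "H a b c = (if a = 0 then x12 else if b = 0 then x20 else x20 / x1)"

lemma H_right: "H a b c * R' a (chi a b c) c = R a b c"
  using nonzero
  by (cases a; cases b; cases c; simp add: H_def x_defs divide_simps)

text \<open>As for \<open>G_bulk\<close>, the cases compare monomials; \<open>x12\<close> and
  \<open>x20\<close> are of this kind too.\<close>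

lemma H_bulk: "H a b c * X' a (chi a b c) c (chi c d e) = X a b c d * H c d e"
  using nonzero
  by (cases a; cases b; cases c; cases d; cases e; simp add: H_def x_defs divide_simps power2_eq_square)

text \<open>The products on the right are already split into a component of \<open>L\<close> and a
  value of \<open>H\<close>, with the bit \<open>c\<close> flipped as
  \<open>chi 1 c d = c + 1\<close> demands in \<open>H_left\<close>.\<close>

lemma left_average: "edge_weight \<alpha> \<beta> b a 0 * L' 0 b c + edge_weight \<alpha> \<beta> b a 1 * L' 1 b c =
    (if b = 0 then x12 else if c = 1 then (if a = 0 then x7 * x20 else x10 * x20)
     else (if a = 0 then x6 else x9) * x20 / x1)"
  using left_identities left_identities_lam(1,2)
  by (cases a; cases b; cases c; simp add: edge_weight_def;
      (algebra | simp add: algebra_simps))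

lemma H_left: "edge_weight \<alpha> \<beta> b a 0 * L' 0 b (chi b c d) + edge_weight \<alpha> \<beta> b a 1 * L' 1 b (chi b c d)
   = L a b c * H b c d"
  unfolding left_average
  by (cases a; cases b; cases c; simp add: H_def)

text \<open>The left edge creates the weight \<open>G\<close>, which \<open>G_bulk\<close> carries
  to the right end, where \<open>G_right\<close> absorbs it.\<close>

lemma G_telescope:
  fixes s :: "nat \<Rightarrow> bit" and m :: nat
  shows "L (s 1) (chi (s 1) (s 2) (s 3)) (s 3) *
    (\<Prod>j = 1..m. X (chi (s (2 * j - 1)) (s (2 * j)) (s (2 * j + 1))) (s (2 * j + 1))
      (chi (s (2 * j + 1)) (s (2 * j + 2)) (s (2 * j + 3))) (s (2 * j + 3))) =
   L' (s 1) (s 2) (s 3) *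
    (\<Prod>j = 1..m. X' (s (2 * j)) (s (2 * j + 1)) (s (2 * j + 2)) (s (2 * j + 3))) *
    G (s (2 * m + 1)) (s (2 * m + 2)) (s (2 * m + 3))"
proof (rule prod_telescope[where g = "\<lambda>j. G (s (2 * j + 1)) (s (2 * j + 2)) (s (2 * j + 3))"])
  show "G (s (2 * j + 1)) (s (2 * j + 2)) (s (2 * j + 3)) *
      X (chi (s (2 * Suc j - 1)) (s (2 * Suc j)) (s (2 * Suc j + 1))) (s (2 * Suc j + 1))
      (chi (s (2 * Suc j + 1)) (s (2 * Suc j + 2)) (s (2 * Suc j + 3))) (s (2 * Suc j + 3)) =
      X' (s (2 * Suc j)) (s (2 * Suc j + 1)) (s (2 * Suc j + 2)) (s (2 * Suc j + 3)) *
      G (s (2 * Suc j + 1)) (s (2 * Suc j + 2)) (s (2 * Suc j + 3))" for j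
    using G_bulk[of "s (2 * j + 1)" "s (2 * j + 2)" "s (2 * j + 3)" "s (2 * j + 4)" "s (2 * j + 5)"]
    by (simp add: eval_nat_numeral)
qed (use G_left[of "s 1" "s 2" "s 3"] in \<open>simp add: eval_nat_numeral\<close>)

text \<open>Starts from the weight \<open>H\<close> that \<open>H_left\<close> produces when the
  first site is summed out, and delivers it to \<open>H_right\<close>.\<close>

lemma H_telescope:
  fixes s :: "nat \<Rightarrow> bit" and m :: nat
  shows "L (s 1) (s 2) (s 3) * H (s 2) (s 3) (s 4) *
    (\<Prod>j = 1..m. X' (s (2 * j)) (chi (s (2 * j)) (s (2 * j + 1)) (s (2 * j + 2))) (s (2 * j + 2))
      (chi (s (2 * j + 2)) (s (2 * j + 3)) (s (2 * j + 4)))) =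
   L (s 1) (s 2) (s 3) *
    (\<Prod>j = 1..m. X (s (2 * j)) (s (2 * j + 1)) (s (2 * j + 2)) (s (2 * j + 3))) *
    H (s (2 * m + 2)) (s (2 * m + 3)) (s (2 * m + 4))"
proof (rule prod_telescope[where g = "\<lambda>j. H (s (2 * j + 2)) (s (2 * j + 3)) (s (2 * j + 4))"])
  show "H (s (2 * j + 2)) (s (2 * j + 3)) (s (2 * j + 4)) *
      X' (s (2 * Suc j)) (chi (s (2 * Suc j)) (s (2 * Suc j + 1)) (s (2 * Suc j + 2))) (s (2 * Suc j + 2))
      (chi (s (2 * Suc j + 2)) (s (2 * Suc j + 3)) (s (2 * Suc j + 4))) =
      X (s (2 * Suc j)) (s (2 * Suc j + 1)) (s (2 * Suc j + 2)) (s (2 * Suc j + 3)) *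
      H (s (2 * Suc j + 2)) (s (2 * Suc j + 3)) (s (2 * Suc j + 4))" for j
    using H_bulk[of "s (2 * j + 2)" "s (2 * j + 3)" "s (2 * j + 4)" "s (2 * j + 5)" "s (2 * j + 6)"]
    by (simp add: eval_nat_numeral)
qed (simp add: eval_nat_numeral)

subsection \<open>The half steps on the patch states\<close>

text \<open>Brings offsets 3 and 4 to the successor form that the simplifier uses for offset 2, so
  that index comparisons are decided.\<close>

lemma add_Suc_numeral: "x + 3 = Suc (Suc (Suc x))" "x + 4 = Suc (Suc (Suc (Suc x)))"
  by simp_all

definition p_fun :: "nat \<Rightarrow> (nat \<Rightarrow> bit) \<Rightarrow> real" where
  "p_fun n s = L (s 1) (s 2) (s 3) *
     (\<Prod>j = 1..n div 2 - 2. X (s (2 * j)) (s (2 * j + 1)) (s (2 * j + 2)) (s (2 * j + 3))) *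
     R (s (n - 2)) (s (n - 1)) (s n)"

definition p'_fun :: "nat \<Rightarrow> (nat \<Rightarrow> bit) \<Rightarrow> real" where
  "p'_fun n s = L' (s 1) (s 2) (s 3) *
     (\<Prod>j = 1..n div 2 - 2. X' (s (2 * j)) (s (2 * j + 1)) (s (2 * j + 2)) (s (2 * j + 3))) *
     R' (s (n - 2)) (s (n - 1)) (s n)"

text \<open>Every site that is read lies between 1 and \<open>n\<close>, where \<open>conf\<close>
  and \<open>site\<close> agree; the largest index in the product is at most
  \<open>n - 1\<close>.\<close>

lemma p_eq:
  assumes "4 \<le> n"
  shows "p n = vec_of n (p_fun n)"
proof -
  have c: "conf n i j = site n i j" if "1 \<le> j" "j \<le> n" for i j
    using that by (simp add: conf_def)
  have "(\<Prod>j = 1..n div 2 - 2. X (conf n i (2 * j)) (conf n i (2 * j + 1)) (conf n i (2 * j + 2))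
      (conf n i (2 * j + 3))) = (\<Prod>j = 1..n div 2 - 2. X (site n i (2 * j)) (site n i (2 * j + 1))
      (site n i (2 * j + 2)) (site n i (2 * j + 3)))" for i
    using assms by (intro prod.cong) (auto simp: c simp del: add_2_eq_Suc')
  then show ?thesis
    using assms by (simp add: p_def vec_of_def p_fun_def Let_def c)
qed

lemma p'_eq:
  assumes "4 \<le> n"
  shows "p' n = vec_of n (p'_fun n)"
proof -
  have c: "conf n i j = site n i j" if "1 \<le> j" "j \<le> n" for i j
    using that by (simp add: conf_def)
  have "(\<Prod>j = 1..n div 2 - 2. X' (conf n i (2 * j)) (conf n i (2 * j + 1)) (conf n i (2 * j + 2))
      (conf n i (2 * j + 3))) = (\<Prod>j = 1..n div 2 - 2. X' (site n i (2 * j)) (site n i (2 * j + 1))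
      (site n i (2 * j + 2)) (site n i (2 * j + 3)))" for i
    using assms by (intro prod.cong) (auto simp: c simp del: add_2_eq_Suc')
  then show ?thesis
    using assms by (simp add: p'_def vec_of_def p'_fun_def Let_def c)
qed

lemma p_fun_pos: "0 < p_fun n s" and p'_fun_pos: "0 < p'_fun n s"
  by (auto simp: p_fun_def p'_fun_def tensors_pos intro!: mult_pos_pos prod_pos)

lemma p'_fun_eq:
  assumes "even n" "4 \<le> n"
  defines "u \<equiv> \<lambda>s. flips {k. even k \<and> 1 < k \<and> k < n} s"
  shows "edge_weight \<gamma> \<delta> (u s (n - 1)) (u s n) 0 * p_fun n ((u s)(n := 0)) +
    edge_weight \<gamma> \<delta> (u s (n - 1)) (u s n) 1 * p_fun n ((u s)(n := 1)) = p'_fun n s"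
proof -
  \<comment> \<open>\<open>m\<close> is the number of bulk tensors; it is 0 for
    \<open>n = 4\<close>.\<close>
  define m where "m = n div 2 - 2"
  have n: "n = 2 * m + 4"
    using assms(1,2) by (auto simp: m_def elim!: evenE)
  have idx: "n div 2 - 2 = m" "n - 2 = 2 * m + 2" "n - 1 = 2 * m + 3"
    by (simp_all add: n add_Suc_numeral)
  define P where "P = (\<Prod>j = 1..m. X (chi (s (2 * j - 1)) (s (2 * j)) (s (2 * j + 1))) (s (2 * j + 1))
      (chi (s (2 * j + 1)) (s (2 * j + 2)) (s (2 * j + 3))) (s (2 * j + 3)))"
  define a b c d where "a = s (2 * m + 1)" "b = s (2 * m + 2)" "c = s (2 * m + 3)" "d = s (2 * m + 4)"
  have "p_fun n ((u s)(n := t)) = L (s 1) (chi (s 1) (s 2) (s 3)) (s 3) * P * R (chi a b c) c t" for t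
  proof -
    \<comment> \<open>In \<open>w\<close> the odd sites keep their old values and the even sites
      below \<open>n\<close> are flipped. The bulk product stops at site \<open>2 * m + 3\<close>,
      so \<open>t\<close> enters only through \<open>R\<close>.\<close>
    define w where "w = (u s)(n := t)"
    have "(\<Prod>j = 1..m. X (w (2 * j)) (w (2 * j + 1)) (w (2 * j + 2)) (w (2 * j + 3))) = P"
      unfolding P_def
    proof (rule prod.cong)
      fix j assume "j \<in> {1..m}"
      then have "w (2 * j) = chi (s (2 * j - 1)) (s (2 * j)) (s (2 * j + 1))" "w (2 * j + 1) = s (2 * j + 1)"
        "w (2 * j + 2) = chi (s (2 * j + 1)) (s (2 * j + 2)) (s (2 * j + 3))" "w (2 * j + 3) = s (2 * j + 3)"
        by (simp_all add: w_def u_def flips_def n add_Suc_numeral)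
      then show "X (w (2 * j)) (w (2 * j + 1)) (w (2 * j + 2)) (w (2 * j + 3)) =
        X (chi (s (2 * j - 1)) (s (2 * j)) (s (2 * j + 1))) (s (2 * j + 1))
          (chi (s (2 * j + 1)) (s (2 * j + 2)) (s (2 * j + 3))) (s (2 * j + 3))"
        by (simp only:)
    qed simp
    moreover have "w 1 = s 1" "w 2 = chi (s 1) (s 2) (s 3)" "w 3 = s 3"
      "w (2 * m + 2) = chi a b c" "w (2 * m + 3) = c" "w n = t"
      by (simp_all add: w_def u_def flips_def n a_b_c_d_def add_Suc_numeral)
    ultimately show ?thesis
      unfolding w_def[symmetric] by (simp only: p_fun_def idx)
  qed
  moreover have "u s (n - 1) = c" "u s n = d"
    unfolding idx by (simp_all add: u_def flips_def n a_b_c_d_def add_Suc_numeral)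
  ultimately have "edge_weight \<gamma> \<delta> (u s (n - 1)) (u s n) 0 * p_fun n ((u s)(n := 0)) +
    edge_weight \<gamma> \<delta> (u s (n - 1)) (u s n) 1 * p_fun n ((u s)(n := 1)) =
    L (s 1) (chi (s 1) (s 2) (s 3)) (s 3) * P * (edge_weight \<gamma> \<delta> c d 0 * R (chi a b c) c 0 +
      edge_weight \<gamma> \<delta> c d 1 * R (chi a b c) c 1)"
    by (simp add: algebra_simps)
  also have "\<dots> = L' (s 1) (s 2) (s 3) *
    (\<Prod>j = 1..m. X' (s (2 * j)) (s (2 * j + 1)) (s (2 * j + 2)) (s (2 * j + 3))) * R' b c d"
    unfolding P_def G_telescope G_right[of a b c d, symmetric] by (simp add: a_b_c_d_def mult.assoc)
  also have "\<dots> = p'_fun n s"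
    unfolding p'_fun_def idx by (simp only: a_b_c_d_def n)
  finally show ?thesis .
qed

lemma p_fun_eq:
  assumes "even n" "4 \<le> n"
  defines "u \<equiv> \<lambda>s. flips {k. odd k \<and> 1 < k \<and> k < n} s"
  shows "edge_weight \<alpha> \<beta> (u s 2) (u s 1) 0 * p'_fun n ((u s)(1 := 0)) +
    edge_weight \<alpha> \<beta> (u s 2) (u s 1) 1 * p'_fun n ((u s)(1 := 1)) = p_fun n s"
proof -
  define m where "m = n div 2 - 2"
  have n: "n = 2 * m + 4"
    using assms(1,2) by (auto simp: m_def elim!: evenE)
  have idx: "n div 2 - 2 = m" "n - 2 = 2 * m + 2" "n - 1 = 2 * m + 3"
    by (simp_all add: n add_Suc_numeral)
  define P where "P = (\<Prod>j = 1..m. X' (s (2 * j)) (chi (s (2 * j)) (s (2 * j + 1)) (s (2 * j + 2)))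
      (s (2 * j + 2)) (chi (s (2 * j + 2)) (s (2 * j + 3)) (s (2 * j + 4))))"
  define b c d where "b = s (2 * m + 2)" "c = s (2 * m + 3)" "d = s (2 * m + 4)"
  have "p'_fun n ((u s)(1 := t)) = L' t (s 2) (chi (s 2) (s 3) (s 4)) * P * R' b (chi b c d) d" for t
  proof -
    \<comment> \<open>Now the even sites are frozen and the odd sites above 1 are flipped, including
      \<open>n - 1\<close>. The new first site \<open>t\<close> enters only through
      \<open>L'\<close>.\<close>
    define w where "w = (u s)(1 := t)"
    have "(\<Prod>j = 1..m. X' (w (2 * j)) (w (2 * j + 1)) (w (2 * j + 2)) (w (2 * j + 3))) = P"
      unfolding P_def
    proof (rule prod.cong)
      fix j assume "j \<in> {1..m}"
      then have "w (2 * j) = s (2 * j)" "w (2 * j + 1) = chi (s (2 * j)) (s (2 * j + 1)) (s (2 * j + 2))"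
        "w (2 * j + 2) = s (2 * j + 2)" "w (2 * j + 3) = chi (s (2 * j + 2)) (s (2 * j + 3)) (s (2 * j + 4))"
        by (simp_all add: w_def u_def flips_def n add_Suc_numeral)
      then show "X' (w (2 * j)) (w (2 * j + 1)) (w (2 * j + 2)) (w (2 * j + 3)) =
        X' (s (2 * j)) (chi (s (2 * j)) (s (2 * j + 1)) (s (2 * j + 2)))
          (s (2 * j + 2)) (chi (s (2 * j + 2)) (s (2 * j + 3)) (s (2 * j + 4)))"
        by (simp only:)
    qed simp
    moreover have "w 1 = t" "w 2 = s 2" "w 3 = chi (s 2) (s 3) (s 4)"
      "w (2 * m + 2) = b" "w (2 * m + 3) = chi b c d" "w n = d"
      by (simp_all add: w_def u_def flips_def n b_c_d_def add_Suc_numeral)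
    ultimately show ?thesis
      unfolding w_def[symmetric] by (simp only: p'_fun_def idx)
  qed
  moreover have "u s 1 = s 1" "u s 2 = s 2"
    by (simp_all add: u_def flips_def)
  ultimately have "edge_weight \<alpha> \<beta> (u s 2) (u s 1) 0 * p'_fun n ((u s)(1 := 0)) +
    edge_weight \<alpha> \<beta> (u s 2) (u s 1) 1 * p'_fun n ((u s)(1 := 1)) =
    (edge_weight \<alpha> \<beta> (s 2) (s 1) 0 * L' 0 (s 2) (chi (s 2) (s 3) (s 4)) +
      edge_weight \<alpha> \<beta> (s 2) (s 1) 1 * L' 1 (s 2) (chi (s 2) (s 3) (s 4))) * P * R' b (chi b c d) d"
    by (simp add: algebra_simps)
  also have "\<dots> = L (s 1) (s 2) (s 3) *
    (\<Prod>j = 1..m. X (s (2 * j)) (s (2 * j + 1)) (s (2 * j + 2)) (s (2 * j + 3))) * R b c d"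
    unfolding H_left P_def H_telescope H_right[of b c d, symmetric] by (simp add: b_c_d_def mult.assoc)
  also have "\<dots> = p_fun n s"
    unfolding p_fun_def idx by (simp only: b_c_d_def n)
  finally show ?thesis .
qed

section \<open>Invariance of the two layers under a full time step\<close>

lemma U_even_p: "even n \<Longrightarrow> 4 \<le> n \<Longrightarrow> U_even \<gamma> \<delta> n *\<^sub>v p n = p' n"
  by (simp only: p_eq p'_eq U_even_mult_vec(2) Let_def p'_fun_eq)

lemma U_odd_p': "even n \<Longrightarrow> 4 \<le> n \<Longrightarrow> U_odd \<alpha> \<beta> n *\<^sub>v p' n = p n"
  by (simp only: p_eq p'_eq U_odd_mult_vec(2) Let_def p_fun_eq)

lemma steady_states:
  assumes n: "even n" "4 \<le> n"
  shows "steady_state (U_odd \<alpha> \<beta> n * U_even \<gamma> \<delta> n) (normalized (p n))"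
    and "steady_state (U_even \<gamma> \<delta> n * U_odd \<alpha> \<beta> n) (normalized (p' n))"
proof -
  note carr = U_even_mult_vec(1)[OF n, of \<gamma> \<delta>] U_odd_mult_vec(1)[OF n, of \<alpha> \<beta>]
  have v: "p n \<in> carrier_vec (2 ^ n)" "p' n \<in> carrier_vec (2 ^ n)"
    by (simp_all add: p_eq p'_eq n vec_of_def)
  have "0 < p n $ i" "0 < p' n $ i" if "i < 2 ^ n" for i
    using that by (simp_all add: p_eq p'_eq n vec_of_def p_fun_pos p'_fun_pos)
  then show "steady_state (U_odd \<alpha> \<beta> n * U_even \<gamma> \<delta> n) (normalized (p n))"
    "steady_state (U_even \<gamma> \<delta> n * U_odd \<alpha> \<beta> n) (normalized (p' n))"
    using carr v by (auto intro!: steady_state_normalized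
        simp: assoc_mult_mat_vec[of _ "2 ^ n" "2 ^ n" _ "2 ^ n"] U_even_p U_odd_p' n)
qed

end

theorem theorem2:
  fixes \<alpha> \<beta> \<gamma> \<delta> :: real
  assumes "0 < \<alpha>" "\<alpha> < 1" "0 < \<beta>" "\<beta> < 1" "0 < \<gamma>" "\<gamma> < 1" "0 < \<delta>" "\<delta> < 1"
  shows
    "(\<forall>a b c d. 0 < patch.X \<alpha> \<beta> \<gamma> \<delta> a b c d \<and> 0 < patch.X' \<alpha> \<beta> \<gamma> \<delta> a b c d) \<and>
     (\<forall>a b c. 0 < patch.L \<alpha> \<beta> \<gamma> \<delta> a b c \<and> 0 < patch.L' \<alpha> \<beta> \<gamma> \<delta> a b c \<and>
              0 < patch.R \<alpha> \<beta> \<gamma> \<delta> a b c \<and> 0 < patch.R' \<alpha> \<beta> \<gamma> \<delta> a b c) \<and>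
     (\<forall>n. even n \<and> 4 \<le> n \<longrightarrow>
        U_even \<gamma> \<delta> n *\<^sub>v patch.p \<alpha> \<beta> \<gamma> \<delta> n = patch.p' \<alpha> \<beta> \<gamma> \<delta> n \<and>
        U_odd \<alpha> \<beta> n *\<^sub>v patch.p' \<alpha> \<beta> \<gamma> \<delta> n = patch.p \<alpha> \<beta> \<gamma> \<delta> n \<and>
        steady_state (U_odd \<alpha> \<beta> n * U_even \<gamma> \<delta> n) (normalized (patch.p \<alpha> \<beta> \<gamma> \<delta> n)) \<and>
        steady_state (U_even \<gamma> \<delta> n * U_odd \<alpha> \<beta> n) (normalized (patch.p' \<alpha> \<beta> \<gamma> \<delta> n)))"
proof -
  interpret patch_open \<alpha> \<beta> \<gamma> \<delta>
    using assms by unfold_locales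
  show ?thesis
    by (simp add: tensors_pos U_even_p U_odd_p' steady_states)
qed

end
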